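(* Let $m\ge 2$ be an integer. For every irredundant cover $U$ of $G_m$, $$5|U|=2m^2-D_U,\qquad D_U=(s_1-|U|)-(s_3+2s_4).$$
   Context: For an integer $m\ge 2$, the grid is $G_m=\{1,\dots,m\}\times\{1,\dots,m\}$; its elements are called squares, and $(i,j)$ is the square in row $i$ and column $j$. For integers $1\le a,b\le m-1$, the card $C_{a,b}$ is the set $\{(a,b),(a+1,b),(a,b+1),(a+1,b+1)\}$, and $\mathcal C_m=\{C_{a,b}:1\le a,b\le m-1\}$. A configuration is a non-empty subset $U\subseteq\mathcal C_m$. The multiplicity of $x\in G_m$ is $\mu(x)=|\{C\in U: x\in C\}|$. A square $x$ is private for $C\in U$ if $x\in C$ and $\mu(x)=1$. $U$ is an irredundant cover of $G_m$ if $\mu(x)\ge 1$ for every $x\in G_m$ and every $C\in U$ contains at least one private square. For a given $U$, $S_j=\{x\in G_m:\mu(x)=j\}$ and $s_j=|S_j|$. The defect $D_U$ of $U$ is defined as $D_U=p_U-(s_3+2s_4)$, where $p_U=s_1-|U|$. *)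

theory Defs
  imports Main
begin

type_synonym square = "nat \<times> nat"

definition grid :: "nat \<Rightarrow> square set" where
  "grid m = {1..m} \<times> {1..m}"

definition card_at :: "nat \<Rightarrow> nat \<Rightarrow> square set" where
  "card_at a b = {(a, b), (a + 1, b), (a, b + 1), (a + 1, b + 1)}"

definition all_cards :: "nat \<Rightarrow> square set set" where
  "all_cards m = {card_at a b | a b. 1 \<le> a \<and> a \<le> m - 1 \<and> 1 \<le> b \<and> b \<le> m - 1}"

definition configuration :: "nat \<Rightarrow> square set set \<Rightarrow> bool" where
  "configuration m U \<longleftrightarrow> U \<noteq> {} \<and> U \<subseteq> all_cards m"

definition multiplicity :: "square set set \<Rightarrow> square \<Rightarrow> nat" where
  "multiplicity U x = card {C \<in> U. x \<in> C}"

definition private_square :: "square set set \<Rightarrow> square set \<Rightarrow> square \<Rightarrow> bool" where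
  "private_square U C x \<longleftrightarrow> x \<in> C \<and> multiplicity U x = 1"

definition irredundant_cover :: "nat \<Rightarrow> square set set \<Rightarrow> bool" where
  "irredundant_cover m U \<longleftrightarrow> configuration m U
     \<and> (\<forall>x \<in> grid m. multiplicity U x \<ge> 1)
     \<and> (\<forall>C \<in> U. \<exists>x. private_square U C x)"

definition mult_class :: "nat \<Rightarrow> square set set \<Rightarrow> nat \<Rightarrow> square set" where
  "mult_class m U j = {x \<in> grid m. multiplicity U x = j}"

definition mult_count :: "nat \<Rightarrow> square set set \<Rightarrow> nat \<Rightarrow> nat" where
  "mult_count m U j = card (mult_class m U j)"

text \<open>The differences below are taken in the integers: the defect can be negative for a general
  configuration, and subtraction on the naturals truncates.\<close>

definition private_excess :: "nat \<Rightarrow> square set set \<Rightarrow> int" where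
  "private_excess m U = int (mult_count m U 1) - int (card U)"

definition defect :: "nat \<Rightarrow> square set set \<Rightarrow> int" where
  "defect m U = private_excess m U - (int (mult_count m U 3) + 2 * int (mult_count m U 4))"

end

theory Submission
  imports Defs
begin

text \<open>
  The identity comes from evaluating the sum over the grid of the discrepancy \<open>2 - \<mu>(x)\<close> in two ways.
  Counting incidences between cards and squares from either side gives \<open>\<Sum> \<mu>(x) = 4|U|\<close>, as every card
  has four squares, all inside the grid; so the discrepancies add up to \<open>2m\<^sup>2 - 4|U|\<close>.
  On the other hand, every square of a cover has multiplicity 1, 2, 3 or 4, where the discrepancy is
  1, 0, -1 or -2, so they add up to \<open>s\<^sub>1 - s\<^sub>3 - 2s\<^sub>4\<close>, which is the defect plus \<open>|U|\<close>.
\<close>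

lemma finite_grid: "finite (grid m)"
  by (simp add: grid_def)

lemma card_grid: "card (grid m) = m\<^sup>2"
  by (simp add: grid_def power2_eq_square)

lemma card_card_at: "card (card_at a b) = 4"
  by (simp add: card_at_def)

lemma all_cards_subset_grid: "C \<in> all_cards m \<Longrightarrow> C \<subseteq> grid m"
  by (auto simp: all_cards_def card_at_def grid_def)

lemma finite_all_cards: "finite (all_cards m)"
  by (rule finite_subset[of _ "Pow (grid m)"]) (auto dest: all_cards_subset_grid simp: finite_grid)

text \<open>A card is determined by its position and by which of its four corners a given square is.\<close>

lemma multiplicity_le_4:
  assumes "U \<subseteq> all_cards m"
  shows "multiplicity U x \<le> 4"
proof -
  obtain i j where x: "x = (i, j)"
    by (cases x)
  let ?T = "{card_at (i - 1) (j - 1), card_at (i - 1) j, card_at i (j - 1), card_at i j}"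
  have "{C \<in> U. x \<in> C} \<subseteq> ?T"
  proof
    fix C assume "C \<in> {C \<in> U. x \<in> C}"
    then obtain a b where C: "C = card_at a b" and "x \<in> card_at a b"
      using assms by (auto simp: all_cards_def)
    then have "(a = i - 1 \<or> a = i) \<and> (b = j - 1 \<or> b = j)"
      by (auto simp: card_at_def x)
    then show "C \<in> ?T"
      unfolding C by blast
  qed
  then have "card {C \<in> U. x \<in> C} \<le> card ?T"
    by (intro card_mono) auto
  also have "card ?T \<le> 4"
    using card_length[of "[card_at (i - 1) (j - 1), card_at (i - 1) j, card_at i (j - 1), card_at i j]"]
    by simp
  finally show ?thesis
    by (simp add: multiplicity_def)
qed

text \<open>The double count of pairs of a card of \<open>U\<close> and a square on it; all four squares of each
  card are seen by the sum because the card lies inside the grid.\<close>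

lemma sum_multiplicity:
  assumes "U \<subseteq> all_cards m"
  shows "(\<Sum>x\<in>grid m. multiplicity U x) = 4 * card U"
proof -
  have "card {x \<in> grid m. x \<in> C} = 4" if "C \<in> U" for C
  proof -
    have C: "C \<in> all_cards m"
      using assms that by blast
    then have "{x \<in> grid m. x \<in> C} = C"
      using all_cards_subset_grid by blast
    moreover have "card C = 4"
      using C card_card_at by (auto simp: all_cards_def)
    ultimately show ?thesis
      by simp
  qed
  moreover have "finite U"
    using assms finite_all_cards finite_subset by blast
  ultimately show ?thesis
    unfolding multiplicity_def
    by (subst sum_multicount) (auto simp: finite_grid)
qed

lemma int_mult_count:
  "int (mult_count m U j) = (\<Sum>x\<in>grid m. if multiplicity U x = j then 1 else 0)"
  by (simp add: mult_count_def mult_class_def finite_grid sum.If_cases Int_def)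

lemma sum_discrepancy:
  assumes "U \<subseteq> all_cards m" and "\<And>x. x \<in> grid m \<Longrightarrow> multiplicity U x \<ge> 1"
  shows "(\<Sum>x\<in>grid m. 2 - int (multiplicity U x))
    = int (mult_count m U 1) - int (mult_count m U 3) - 2 * int (mult_count m U 4)"
proof -
  let ?\<delta> = "\<lambda>x j. if multiplicity U x = j then 1 else 0 :: int"
  have "2 - int (multiplicity U x) = ?\<delta> x 1 - ?\<delta> x 3 - 2 * ?\<delta> x 4" if "x \<in> grid m" for x
    using assms(2)[OF that] multiplicity_le_4[OF assms(1), of x] by auto
  then have "(\<Sum>x\<in>grid m. 2 - int (multiplicity U x))
      = (\<Sum>x\<in>grid m. ?\<delta> x 1 - ?\<delta> x 3 - 2 * ?\<delta> x 4)"
    by (rule sum.cong[OF refl])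
  then show ?thesis
    by (simp only: int_mult_count sum_subtractf sum_distrib_left)
qed

theorem theorem3p1:
  fixes m :: nat and U :: "square set set"
  assumes "m \<ge> 2"
    and "irredundant_cover m U"
  shows "5 * int (card U) = 2 * (int m)^2 - defect m U
    \<and> defect m U = (int (mult_count m U 1) - int (card U))
        - (int (mult_count m U 3) + 2 * int (mult_count m U 4))"
proof -
  have U: "U \<subseteq> all_cards m" and cover: "\<And>x. x \<in> grid m \<Longrightarrow> multiplicity U x \<ge> 1"
    using assms(2) by (auto simp: irredundant_cover_def configuration_def)
  have "(\<Sum>x\<in>grid m. 2 - int (multiplicity U x))
      = 2 * int (card (grid m)) - int (\<Sum>x\<in>grid m. multiplicity U x)"
    by (simp add: sum_subtractf)
  also have "\<dots> = 2 * (int m)\<^sup>2 - 4 * int (card U)"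
    by (simp add: card_grid sum_multiplicity[OF U])
  finally show ?thesis
    using sum_discrepancy[OF U cover] by (simp add: defect_def private_excess_def)
qed

end
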